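(* Let $\mu_1,\mu_2$ be finitely supported probability laws on a grid $h\mathbb{Z}$ ($h>0$) with cumulant generating functions $\lambda_1,\lambda_2$, let $\mu=\mu_1*\mu_2$, and let $\phi\in\mathbb{R}$. Then $$\mu^{(\phi)}=\mu_1^{(\phi)}*\mu_2^{(\phi)},\qquad \Lambda_\mu=\lambda_1+\lambda_2 .$$ Hence for finitely many such laws $\mu_1,\dots,\mu_m$ with cumulant generating functions $\lambda_1,\dots,\lambda_m$, $(\mu_1*\cdots*\mu_m)^{(\phi)}=\mu_1^{(\phi)}*\cdots*\mu_m^{(\phi)}$, and the cumulant generating function of $\mu_1*\cdots*\mu_m$ is $\sum_i\lambda_i$.
   Context: For a grid law $\mu$, its cumulant generating function is $\Lambda_\mu(\phi)=\ln\sum_w e^{\phi w}\mu(w)$, and its exponential tilt by $\phi$ is $\mu^{(\phi)}(w)=e^{\phi w-\Lambda_\mu(\phi)}\mu(w)$. $*$ denotes convolution. *)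

theory Defs
  imports "HOL-Probability.Probability"
begin

definition fin_grid_law :: "real \<Rightarrow> real pmf \<Rightarrow> bool" where
  "fin_grid_law h \<mu> \<longleftrightarrow>
     finite (set_pmf \<mu>) \<and> set_pmf \<mu> \<subseteq> range (\<lambda>k::int. h * of_int k)"

definition cgf :: "real pmf \<Rightarrow> real \<Rightarrow> real" where
  "cgf \<mu> \<phi> = ln (\<Sum>\<^sub>\<infinity>w. exp (\<phi> * w) * pmf \<mu> w)"

(* embed_pmf is only meaningful when the weights sum to 1; for finitely supported
   laws this always holds, see pmf_tilt below. *)
definition tilt :: "real \<Rightarrow> real pmf \<Rightarrow> real pmf" where
  "tilt \<phi> \<mu> = embed_pmf (\<lambda>w. exp (\<phi> * w - cgf \<mu> \<phi>) * pmf \<mu> w)"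

(* The library's convolution acts on Borel measures, whereas measure_pmf lives on the
   discrete sigma-algebra; pmf_conv_pmf gives the pointwise formula. *)
definition conv_pmf :: "real pmf \<Rightarrow> real pmf \<Rightarrow> real pmf" (infixr "\<circledast>" 70) where
  "\<mu> \<circledast> \<nu> = map_pmf (\<lambda>(x, y). x + y) (pair_pmf \<mu> \<nu>)"

(* The empty convolution is the unit mass at 0, the neutral element of convolution. *)
definition conv_list :: "real pmf list \<Rightarrow> real pmf" where
  "conv_list \<mu>s = foldr (\<circledast>) \<mu>s (return_pmf 0)"

lemma conv_list_single: "conv_list [\<mu>] = \<mu>"
  by (simp add: conv_list_def conv_pmf_def pair_return_pmf2 map_pmf_comp)

lemma pmf_conv_pmf:
  "pmf (\<mu> \<circledast> \<nu>) w = measure_pmf.expectation \<mu> (\<lambda>x. pmf \<nu> (w - x))"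
proof -
  have "\<mu> \<circledast> \<nu> = bind_pmf \<mu> (\<lambda>x. map_pmf ((+) x) \<nu>)"
    by (simp add: conv_pmf_def pair_pmf_def map_bind_pmf map_pmf_def bind_assoc_pmf
        bind_return_pmf)
  moreover have "pmf (map_pmf ((+) x) \<nu>) w = pmf \<nu> (w - x)" for x
    using pmf_map_inj'[of "(+) x" \<nu> "w - x"] by simp
  ultimately show ?thesis by (simp add: pmf_bind)
qed

lemma pmf_conv_pmf_finite:
  assumes "finite (set_pmf \<mu>)"
  shows "pmf (\<mu> \<circledast> \<nu>) w = (\<Sum>x\<in>set_pmf \<mu>. pmf \<mu> x * pmf \<nu> (w - x))"
  unfolding pmf_conv_pmf by (subst integral_measure_pmf[OF assms]) auto

lemma cgf_finite:
  assumes "finite (set_pmf \<mu>)"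
  shows "cgf \<mu> \<phi> = ln (\<Sum>w\<in>set_pmf \<mu>. exp (\<phi> * w) * pmf \<mu> w)"
proof -
  have "(\<Sum>\<^sub>\<infinity>w. exp (\<phi> * w) * pmf \<mu> w) = (\<Sum>\<^sub>\<infinity>w\<in>set_pmf \<mu>. exp (\<phi> * w) * pmf \<mu> w)"
    by (rule infsum_cong_neutral) (auto simp: set_pmf_iff)
  then show ?thesis using assms by (simp add: cgf_def)
qed

lemma pmf_tilt:
  assumes fin: "finite (set_pmf \<mu>)"
  shows "pmf (tilt \<phi> \<mu>) w = exp (\<phi> * w - cgf \<mu> \<phi>) * pmf \<mu> w"
proof -
  let ?S = "\<Sum>w\<in>set_pmf \<mu>. exp (\<phi> * w) * pmf \<mu> w"
  let ?f = "\<lambda>w. exp (\<phi> * w - cgf \<mu> \<phi>) * pmf \<mu> w"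
  have "?S > 0"
    using fin set_pmf_not_empty by (intro sum_pos) (auto simp: pmf_positive)
  then have "exp (cgf \<mu> \<phi>) = ?S"
    by (simp add: cgf_finite[OF fin])
  then have "(\<Sum>w\<in>set_pmf \<mu>. ?f w) = 1"
    using \<open>?S > 0\<close> by (simp add: exp_diff flip: sum_divide_distrib)
  moreover have "(\<integral>\<^sup>+ w. ennreal (?f w) \<partial>count_space UNIV) = (\<Sum>w\<in>set_pmf \<mu>. ennreal (?f w))"
    by (rule nn_integral_count_space'[OF fin]) (auto simp: set_pmf_iff)
  ultimately have "(\<integral>\<^sup>+ w. ennreal (?f w) \<partial>count_space UNIV) = 1"
    by (simp add: sum_ennreal)
  then show ?thesis
    unfolding tilt_def by (intro pmf_embed_pmf) auto
qed

lemma fin_grid_law_tilt: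
  assumes "fin_grid_law h \<mu>"
  shows "fin_grid_law h (tilt \<phi> \<mu>)"
proof -
  have "set_pmf (tilt \<phi> \<mu>) = set_pmf \<mu>"
    using assms by (auto simp: fin_grid_law_def set_pmf_iff pmf_tilt)
  then show ?thesis using assms by (simp add: fin_grid_law_def)
qed

end

theory Submission
  imports Defs
begin

text \<open>The weight exp(t*w) turns sums into products, and \<mu> \<circledast> \<nu> is the law
  of a sum of independent variables. Hence moment generating functions multiply
  (\<open>expectation_exp_conv_pmf\<close>), and taking logarithms makes \<open>cgf\<close> additive
  (\<open>cgf_conv_pmf\<close>). So the normalised weight exp(\<phi>*w - cgf) also factors along
  every splitting w = x + (w - x) and can be moved inside the convolution sum, which gives
  \<open>tilt_conv_pmf\<close>. Induction on the list, starting from the unit mass at 0, extends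
  both identities to finitely many laws.\<close>

lemma set_pmf_tilt:
  assumes "finite (set_pmf \<mu>)"
  shows "set_pmf (tilt \<phi> \<mu>) = set_pmf \<mu>"
  using assms by (auto simp: set_pmf_iff pmf_tilt)

lemma set_conv_pmf: "set_pmf (\<mu> \<circledast> \<nu>) = (\<lambda>(x, y). x + y) ` (set_pmf \<mu> \<times> set_pmf \<nu>)"
  by (simp add: conv_pmf_def)

text \<open>Writing the sum as an expectation lets it be transported through \<open>map_pmf\<close>
  and \<open>pair_pmf\<close>, from which \<circledast> is built.\<close>

lemma cgf_eq_ln_expectation:
  assumes "finite (set_pmf \<mu>)"
  shows "cgf \<mu> t = ln (measure_pmf.expectation \<mu> (\<lambda>w. exp (t * w)))"
  by (subst integral_measure_pmf[OF assms]) (auto simp: cgf_finite[OF assms] mult.commute)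

text \<open>Positivity is what allows the logarithm of a product to be split in
  \<open>cgf_conv_pmf\<close>.\<close>

lemma expectation_exp_pos:
  assumes "finite (set_pmf \<mu>)"
  shows "measure_pmf.expectation \<mu> (\<lambda>w. exp (t * w)) > (0 :: real)"
  by (subst integral_measure_pmf[OF assms])
     (auto intro!: sum_pos simp: assms set_pmf_not_empty pmf_positive)

text \<open>By independence: exp(t*(x + y)) = exp(t*x) * exp(t*y), and the finite double sum over
  the product of the supports factors.\<close>

lemma expectation_exp_conv_pmf:
  fixes t :: real
  assumes "finite (set_pmf \<mu>)" "finite (set_pmf \<nu>)"
  shows "measure_pmf.expectation (\<mu> \<circledast> \<nu>) (\<lambda>w. exp (t * w)) =
         measure_pmf.expectation \<mu> (\<lambda>w. exp (t * w)) * measure_pmf.expectation \<nu> (\<lambda>w. exp (t * w))"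
proof -
  have "measure_pmf.expectation (\<mu> \<circledast> \<nu>) (\<lambda>w. exp (t * w)) =
        measure_pmf.expectation (pair_pmf \<mu> \<nu>) (\<lambda>z. exp (t * fst z) * exp (t * snd z))"
    by (simp add: conv_pmf_def case_prod_unfold distrib_left exp_add)
  also have "\<dots> = (\<Sum>z\<in>set_pmf \<mu> \<times> set_pmf \<nu>. pmf (pair_pmf \<mu> \<nu>) z * (exp (t * fst z) * exp (t * snd z)))"
    using assms by (subst integral_measure_pmf[of "set_pmf \<mu> \<times> set_pmf \<nu>"]) auto
  also have "\<dots> = (\<Sum>x\<in>set_pmf \<mu>. \<Sum>y\<in>set_pmf \<nu>. (pmf \<mu> x * exp (t * x)) * (pmf \<nu> y * exp (t * y)))"
    unfolding sum.cartesian_product by (rule sum.cong) (auto simp: pmf_pair mult_ac)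
  also have "\<dots> = (\<Sum>x\<in>set_pmf \<mu>. pmf \<mu> x * exp (t * x)) * (\<Sum>y\<in>set_pmf \<nu>. pmf \<nu> y * exp (t * y))"
    by (simp add: sum_product)
  also have "\<dots> = measure_pmf.expectation \<mu> (\<lambda>w. exp (t * w)) *
                  measure_pmf.expectation \<nu> (\<lambda>w. exp (t * w))"
    using assms by (simp add: integral_measure_pmf[of "set_pmf \<mu>"] integral_measure_pmf[of "set_pmf \<nu>"])
  finally show ?thesis .
qed

lemma cgf_conv_pmf:
  assumes "finite (set_pmf \<mu>)" "finite (set_pmf \<nu>)"
  shows "cgf (\<mu> \<circledast> \<nu>) t = cgf \<mu> t + cgf \<nu> t"
proof -
  have "finite (set_pmf (\<mu> \<circledast> \<nu>))"
    using assms by (simp add: set_conv_pmf)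
  then show ?thesis
    using expectation_exp_pos[OF assms(1), of t] expectation_exp_pos[OF assms(2), of t]
    by (simp add: cgf_eq_ln_expectation assms expectation_exp_conv_pmf ln_mult)
qed

lemma tilt_conv_pmf:
  assumes "finite (set_pmf \<mu>)" "finite (set_pmf \<nu>)"
  shows "tilt \<phi> (\<mu> \<circledast> \<nu>) = tilt \<phi> \<mu> \<circledast> tilt \<phi> \<nu>"
proof (rule pmf_eqI)
  fix w
  \<comment> \<open>The part \<phi>*x of the exponent goes to \<mu> and \<phi>*(w - x) to \<nu>; the
    left side does not depend on x, so this applies to each summand.\<close>
  have weight: "exp (\<phi> * w - (cgf \<mu> \<phi> + cgf \<nu> \<phi>)) =
        exp (\<phi> * x - cgf \<mu> \<phi>) * exp (\<phi> * (w - x) - cgf \<nu> \<phi>)" for x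
    by (simp add: algebra_simps flip: exp_add)
  have "pmf (tilt \<phi> (\<mu> \<circledast> \<nu>)) w = exp (\<phi> * w - (cgf \<mu> \<phi> + cgf \<nu> \<phi>)) *
          (\<Sum>x\<in>set_pmf \<mu>. pmf \<mu> x * pmf \<nu> (w - x))"
    using assms by (simp add: pmf_tilt set_conv_pmf cgf_conv_pmf pmf_conv_pmf_finite)
  also have "\<dots> = (\<Sum>x\<in>set_pmf \<mu>. pmf (tilt \<phi> \<mu>) x * pmf (tilt \<phi> \<nu>) (w - x))"
    unfolding sum_distrib_left
  proof (rule sum.cong)
    fix x
    show "exp (\<phi> * w - (cgf \<mu> \<phi> + cgf \<nu> \<phi>)) * (pmf \<mu> x * pmf \<nu> (w - x)) =
          pmf (tilt \<phi> \<mu>) x * pmf (tilt \<phi> \<nu>) (w - x)"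
      unfolding weight[of x] using assms by (simp add: pmf_tilt mult_ac)
  qed simp
  \<comment> \<open>Tilting keeps the support, so this is already the convolution sum of the tilted
    laws.\<close>
  also have "\<dots> = pmf (tilt \<phi> \<mu> \<circledast> tilt \<phi> \<nu>) w"
    using assms by (simp add: pmf_conv_pmf_finite set_pmf_tilt)
  finally show "pmf (tilt \<phi> (\<mu> \<circledast> \<nu>)) w = pmf (tilt \<phi> \<mu> \<circledast> tilt \<phi> \<nu>) w" .
qed

lemma cgf_return_pmf: "cgf (return_pmf x) t = t * x"
  by (simp add: cgf_finite)

text \<open>At the only atom x the normaliser \<phi>*x cancels the exponent. With x = 0 this is the
  base case for lists.\<close>

lemma tilt_return_pmf: "tilt \<phi> (return_pmf x) = return_pmf x"
  by (rule pmf_eqI) (simp add: pmf_tilt cgf_return_pmf indicator_def)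

lemma conv_list_simps:
  "conv_list [] = return_pmf 0"
  "conv_list (\<mu> # \<mu>s) = \<mu> \<circledast> conv_list \<mu>s"
  by (simp_all add: conv_list_def)

text \<open>Makes the two-factor lemmas applicable to the convolution of the tail in the inductions
  below.\<close>

lemma finite_set_conv_list:
  "(\<And>\<mu>. \<mu> \<in> set \<mu>s \<Longrightarrow> finite (set_pmf \<mu>)) \<Longrightarrow> finite (set_pmf (conv_list \<mu>s))"
  by (induction \<mu>s) (auto simp: conv_list_simps set_conv_pmf)

lemma tilt_conv_list:
  "(\<And>\<mu>. \<mu> \<in> set \<mu>s \<Longrightarrow> finite (set_pmf \<mu>)) \<Longrightarrow>
    tilt \<phi> (conv_list \<mu>s) = conv_list (map (tilt \<phi>) \<mu>s)"
  by (induction \<mu>s)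
     (auto simp: conv_list_simps tilt_return_pmf tilt_conv_pmf finite_set_conv_list)

lemma cgf_conv_list:
  "(\<And>\<mu>. \<mu> \<in> set \<mu>s \<Longrightarrow> finite (set_pmf \<mu>)) \<Longrightarrow>
    cgf (conv_list \<mu>s) t = (\<Sum>\<mu>\<leftarrow>\<mu>s. cgf \<mu> t)"
  by (induction \<mu>s)
     (auto simp: conv_list_simps cgf_return_pmf cgf_conv_pmf finite_set_conv_list)

theorem lemma4p2:
  fixes h \<phi> :: real
  assumes "h > 0"
  shows "(\<forall>\<mu>\<^sub>1 \<mu>\<^sub>2. fin_grid_law h \<mu>\<^sub>1 \<and> fin_grid_law h \<mu>\<^sub>2 \<longrightarrow>
            tilt \<phi> (\<mu>\<^sub>1 \<circledast> \<mu>\<^sub>2) = tilt \<phi> \<mu>\<^sub>1 \<circledast> tilt \<phi> \<mu>\<^sub>2 \<and>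
            cgf (\<mu>\<^sub>1 \<circledast> \<mu>\<^sub>2) = (\<lambda>t. cgf \<mu>\<^sub>1 t + cgf \<mu>\<^sub>2 t)) \<and>
         (\<forall>\<mu>s. (\<forall>\<mu>\<in>set \<mu>s. fin_grid_law h \<mu>) \<longrightarrow>
            tilt \<phi> (conv_list \<mu>s) = conv_list (map (tilt \<phi>) \<mu>s) \<and>
            cgf (conv_list \<mu>s) = (\<lambda>t. \<Sum>\<mu>\<leftarrow>\<mu>s. cgf \<mu> t))"
  by (auto simp: fin_grid_law_def tilt_conv_pmf cgf_conv_pmf tilt_conv_list cgf_conv_list)

end
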